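(* (A) Let $f\in\mathcal C_{\mathbb E^2}(\eta)$ with $F(t_0)=0$. The transport matrix $u^\lambda$ defines a curve (1) in $\mathcal C_{\mathbb S^2}$ for each $\lambda\in\mathbb R\setminus\{0\}$; (2) in $\mathcal C_{\mathbb H^2}$ for each $\lambda\in i\mathbb R$ with $|\lambda|\in(0,\frac1\eta)$. This curve, denoted $\mathcal T^\lambda f$, has points $\mathcal T^\lambda F=(\Phi^\lambda)^{-1}\mathbf k\,\Phi^\lambda$. (B) The transport matrix (1) $u^1$ for a curve $f\in\mathcal C_{\mathbb S^2}$ with $F(t_0)=\mathbf k$, or (2) $iu^1$ for a curve $f\in\mathcal C_{\mathbb H^2}$ with $F(t_0)=\mathbf k$, defines a curve in $\mathcal C_{\mathbb E^2}$ (denoted $\mathcal T^1f$).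
   Context: **Matrices and models.** Let $\sigma_0=\begin{pmatrix}1&0\\0&1\end{pmatrix}$, $\sigma_1=\begin{pmatrix}0&1\\1&0\end{pmatrix}$, $\sigma_2=\begin{pmatrix}0&-i\\i&0\end{pmatrix}$, $\sigma_3=\begin{pmatrix}1&0\\0&-1\end{pmatrix}$ and $\mathbf 1=\sigma_0$, $\mathbf i=-i\sigma_1$, $\mathbf j=-i\sigma_2$, $\mathbf k=-i\sigma_3$. For $F\in\mathbb C^{2\times2}$, $F^*$ is the adjugate matrix and $\langle F,G\rangle=\frac12\mathrm{tr}(FG^* )$. Models: $\mathbb E^2=\mathrm{span}_{\mathbb R}\{\mathbf i,\mathbf j\}$, $\mathbb S^2=\{F\in\mathrm{span}_{\mathbb R}\{\mathbf i,\mathbf j,\mathbf k\}:\det F=1\}$, $\mathbb H^2=\{F\in\mathrm{span}_{\mathbb R}\{\sigma_1,\sigma_2,\mathbf k\}:\det F=1\}$ (a two-sheeted hyperboloid). The distance of $F,G$ is $\sqrt{\langle G-F,G-F\rangle}$, $\arccos\langle F,G\rangle$, $\operatorname{arcosh}\langle F,G\rangle$ (same sheet), respectively. A point $f$ is represented by the matrix $F$. **Curves.** $\mathcal V=\mathbb Z$, edges $\mathcal{E}$ join consecutive integers in increasing direction, $t_0\in\mathcal V$ is a fixed initial vertex. Subscripts $0,1$ denote values at two consecutive vertices, $01$ the edge between them. $\mathcal C_{\mathcal Q}$ is the set of $f:\mathcal V\to\mathcal Q$ with constant distance between consecutive points, any three consecutive points pairwise distinct, consecutive points not antipodal if $\mathcal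 Q=\mathbb S^2$, and all points on one sheet if $\mathcal Q=\mathbb H^2$ (geodesic edges oriented by the curve direction). $\mathcal C_{\mathbb E^2}(\eta)$, $\eta>0$, consists of the curves with $\langle F_1-F_0,F_1-F_0\rangle=\eta^2$. Transport matrix $u:\mathcal E\to\mathbb C^{2\times2}$: $u_{01}=F_1-F_0$ for $\mathbb E^2$, $u_{01}=F_1F_0^{-1}$ for $\mathbb S^2,\mathbb H^2$. Initial points are fixed to $F(t_0)=0$ in $\mathbb E^2$ and $F(t_0)=\mathbf k$ in $\mathbb S^2,\mathbb H^2$ (this also holds for the newly defined curves), so that a curve is determined by its transport matrix; "a transport matrix defines a curve in $\mathcal C_{\mathcal Q}$" means that the map determined by it and the initial point takes values in $\mathcal Q$ and belongs to $\mathcal C_{\mathcal Q}$. **Associated maps.** For $\lambda\in\mathbb C$ such that $\mathbf 1\pm\lambda u_{01}$ is invertible for all edges, $\Phi^\lambda:\mathcal V\to\mathbb C^{2\times2}$ is defined by $\Phi^\lambda(t_0)=\mathbf 1$, $\Phi^\lambda_1=(\mathbf 1+\lambda u_{01})\Phi^\lambda_0$, and $u^\lambda_{01}=(\Phi^\lambda_1)^{-1}(\mathbf 1-\lambda u_{01})\Phi^\lambda_0$. *)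

theory Defs
  imports "HOL-Analysis.Analysis"
begin

type_synonym cmat = "complex^2^2"

definition cmat_of :: "complex \<Rightarrow> complex \<Rightarrow> complex \<Rightarrow> complex \<Rightarrow> cmat" where
  "cmat_of a b c d = vector [vector [a, b], vector [c, d]]"

definition cscale :: "complex \<Rightarrow> cmat \<Rightarrow> cmat" where
  "cscale c A = map_matrix (\<lambda>z. c * z) A"

definition sigma1 :: cmat where "sigma1 = cmat_of 0 1 1 0"
definition sigma2 :: cmat where "sigma2 = cmat_of 0 (-\<i>) \<i> 0"
definition sigma3 :: cmat where "sigma3 = cmat_of 1 0 0 (-1)"

definition qi :: cmat where "qi = cscale (-\<i>) sigma1"
definition qj :: cmat where "qj = cscale (-\<i>) sigma2"
definition qk :: cmat where "qk = cscale (-\<i>) sigma3"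

definition adjugate :: "cmat \<Rightarrow> cmat" where
  "adjugate F = cmat_of (F $ 2 $ 2) (- (F $ 1 $ 2)) (- (F $ 2 $ 1)) (F $ 1 $ 1)"

definition mip :: "cmat \<Rightarrow> cmat \<Rightarrow> complex" where
  "mip F G = trace (F ** adjugate G) / 2"

datatype space = Euclidean | Spherical | Hyperbolic

(* span is the linear span over the reals. *)
fun model :: "space \<Rightarrow> cmat set" where
  "model Euclidean = span {qi, qj}"
| "model Spherical = {F \<in> span {qi, qj, qk}. det F = 1}"
| "model Hyperbolic = {F \<in> span {sigma1, sigma2, qk}. det F = 1}"

(* On F = a sigma1 + b sigma2 + c qk the determinant is c^2 - a^2 - b^2, so the
   two sheets of the hyperboloid are separated by the sign of c. *)
definition upper_sheet :: "cmat set" where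
  "upper_sheet = {F \<in> model Hyperbolic.
     \<exists>a b c. F = a *\<^sub>R sigma1 + b *\<^sub>R sigma2 + c *\<^sub>R qk \<and> c > 0}"

definition lower_sheet :: "cmat set" where
  "lower_sheet = {F \<in> model Hyperbolic.
     \<exists>a b c. F = a *\<^sub>R sigma1 + b *\<^sub>R sigma2 + c *\<^sub>R qk \<and> c < 0}"

(* mip is real-valued on each model; Re only adjusts the type. The hyperbolic
   distance is meaningful for points on the same sheet only. *)
fun model_dist :: "space \<Rightarrow> cmat \<Rightarrow> cmat \<Rightarrow> real" where
  "model_dist Euclidean F G = sqrt (Re (mip (G - F) (G - F)))"
| "model_dist Spherical F G = arccos (Re (mip F G))"
| "model_dist Hyperbolic F G = arcosh (Re (mip F G))"

definition curves :: "space \<Rightarrow> (int \<Rightarrow> cmat) set" where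
  "curves Q = {F.
     (\<forall>t. F t \<in> model Q) \<and>
     (\<exists>d. \<forall>t. model_dist Q (F t) (F (t + 1)) = d) \<and>
     (\<forall>t. F t \<noteq> F (t + 1) \<and> F (t + 1) \<noteq> F (t + 2) \<and> F t \<noteq> F (t + 2)) \<and>
     (Q = Spherical \<longrightarrow> (\<forall>t. F (t + 1) \<noteq> - F t)) \<and>
     (Q = Hyperbolic \<longrightarrow> range F \<subseteq> upper_sheet \<or> range F \<subseteq> lower_sheet)}"

definition euclidean_curves :: "real \<Rightarrow> (int \<Rightarrow> cmat) set" where
  "euclidean_curves \<eta> = {F \<in> curves Euclidean.
     \<forall>t. mip (F (t + 1) - F t) (F (t + 1) - F t) = complex_of_real (\<eta>\<^sup>2)}"

fun base_point :: "space \<Rightarrow> cmat" where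
  "base_point Euclidean = 0"
| "base_point Spherical = qk"
| "base_point Hyperbolic = qk"

(* Functions on edges are indexed by the initial vertex: the value at t belongs
   to the edge from t to t + 1. *)
fun transport :: "space \<Rightarrow> (int \<Rightarrow> cmat) \<Rightarrow> int \<Rightarrow> cmat" where
  "transport Euclidean F t = F (t + 1) - F t"
| "transport Spherical F t = F (t + 1) ** matrix_inv (F t)"
| "transport Hyperbolic F t = F (t + 1) ** matrix_inv (F t)"

(* F is a priori an arbitrary matrix-valued map. The invertibility clause makes the
   quotients in the transport matrix meaningful, as matrix_inv is unspecified on
   singular matrices. *)
definition determined_by :: "space \<Rightarrow> int \<Rightarrow> (int \<Rightarrow> cmat) \<Rightarrow> (int \<Rightarrow> cmat) \<Rightarrow> bool" where
  "determined_by Q t0 u F \<longleftrightarrow>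
     F t0 = base_point Q \<and>
     (Q \<noteq> Euclidean \<longrightarrow> (\<forall>t. invertible (F t))) \<and>
     (\<forall>t. transport Q F t = u t)"

definition curve_of :: "space \<Rightarrow> int \<Rightarrow> (int \<Rightarrow> cmat) \<Rightarrow> int \<Rightarrow> cmat" where
  "curve_of Q t0 u = (THE F. determined_by Q t0 u F)"

definition defines_curve :: "space \<Rightarrow> int \<Rightarrow> (int \<Rightarrow> cmat) \<Rightarrow> bool" where
  "defines_curve Q t0 u \<longleftrightarrow>
     (\<exists>!F. determined_by Q t0 u F) \<and> curve_of Q t0 u \<in> curves Q"

definition admissible :: "complex \<Rightarrow> (int \<Rightarrow> cmat) \<Rightarrow> bool" where
  "admissible lam u \<longleftrightarrow>
     (\<forall>t. invertible (mat 1 + cscale lam (u t)) \<and> invertible (mat 1 - cscale lam (u t)))"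

definition assoc_map :: "int \<Rightarrow> complex \<Rightarrow> (int \<Rightarrow> cmat) \<Rightarrow> int \<Rightarrow> cmat" where
  "assoc_map t0 lam u = (THE \<Phi>. \<Phi> t0 = mat 1 \<and>
     (\<forall>t. \<Phi> (t + 1) = (mat 1 + cscale lam (u t)) ** \<Phi> t))"

definition assoc_transport :: "int \<Rightarrow> complex \<Rightarrow> (int \<Rightarrow> cmat) \<Rightarrow> int \<Rightarrow> cmat" where
  "assoc_transport t0 lam u t =
     matrix_inv (assoc_map t0 lam u (t + 1)) ** (mat 1 - cscale lam (u t)) ** assoc_map t0 lam u t"

lemma matrix_inv_works:
  fixes A :: cmat
  assumes "invertible A"
  shows "A ** matrix_inv A = mat 1" "matrix_inv A ** A = mat 1"
  using someI_ex[OF assms[unfolded invertible_def]] unfolding matrix_inv_def by auto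

lemma matrix_recursion_ex1:
  fixes A :: "int \<Rightarrow> cmat"
  assumes inv: "\<And>t. invertible (A t)"
  shows "\<exists>!\<Phi>. \<Phi> t0 = X \<and> (\<forall>t. \<Phi> (t + 1) = A t ** \<Phi> t)"
proof -
  have l: "matrix_inv (A t) ** (A t ** Y) = Y" "A t ** (matrix_inv (A t) ** Y) = Y" for t Y
    using inv[of t]
    by (simp_all add: matrix_mul_assoc matrix_inv_works)
  define f where "f = rec_nat X (\<lambda>n Y. A (t0 + int n) ** Y)"
  define g where "g = rec_nat X (\<lambda>n Y. matrix_inv (A (t0 - int n - 1)) ** Y)"
  define P where "P t = (if t \<ge> t0 then f (nat (t - t0)) else g (nat (t0 - t)))" for t
  have "P (t + 1) = A t ** P t" for t
  proof (cases "t \<ge> t0")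
    case True
    then have "nat (t + 1 - t0) = Suc (nat (t - t0))" by simp
    with True show ?thesis by (simp add: P_def f_def)
  next
    case False
    then have n: "nat (t0 - t) = Suc (nat (t0 - (t + 1)))" by simp
    have e: "P (t + 1) = g (nat (t0 - (t + 1)))"
      using False by (auto simp: P_def f_def g_def)
    have "t0 - int (nat (t0 - (t + 1))) - 1 = t" using False by simp
    then have "P t = matrix_inv (A t) ** g (nat (t0 - (t + 1)))"
      using False unfolding P_def n by (simp add: g_def)
    with e show ?thesis by (simp only: l)
  qed
  moreover have "P t0 = X" by (simp add: P_def f_def)
  moreover have "R = S"
    if R: "R t0 = X" "\<And>t. R (t + 1) = A t ** R t"
      and S: "S t0 = X" "\<And>t. S (t + 1) = A t ** S t" for R S
  proof
    fix t
    show "R t = S t"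
    proof (induction t rule: int_induct[where k = t0])
      case base
      show ?case using R S by simp
    next
      case (step1 i)
      then show ?case using R S by simp
    next
      case (step2 i)
      have "R i = A (i - 1) ** R (i - 1)" "S i = A (i - 1) ** S (i - 1)"
        using R(2)[of "i - 1"] S(2)[of "i - 1"] by simp_all
      with step2 l show ?case by metis
    qed
  qed
  ultimately show ?thesis by (intro ex1I[of _ P]) blast+
qed

lemma assoc_map_rec:
  assumes "admissible lam u"
  shows "assoc_map t0 lam u t0 = mat 1"
    and "assoc_map t0 lam u (t + 1) = (mat 1 + cscale lam (u t)) ** assoc_map t0 lam u t"
  using theI'[OF matrix_recursion_ex1[of "\<lambda>t. mat 1 + cscale lam (u t)" t0 "mat 1"]] assms
  unfolding assoc_map_def admissible_def by blast+

end

(*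
  In all cases the new transport matrix on an edge is the conjugate, by the associated map at
  either end of the edge, of the Cayley transform (1 + w)^-1 (1 - w) of w = lam u.  In (A), w
  anticommutes with k, so conjugating k by 1 + w multiplies it by the Cayley transform, and the
  conjugates of k by the associated map form the new curve.  In (B), conjugating F_1 by 1 + u
  gives F_0, so the conjugate of F by the associated map is constantly k; as the Cayley transform
  of u anticommutes with F_0, the new transport matrix anticommutes with k and hence lies in the
  plane.  The spherical and hyperbolic cases differ only in whether the quaternions or the split
  quaternions are preserved.
*)

theory Submission
  imports Defs
begin

section \<open>Two-by-two complex matrices\<close>

text \<open>Conjugation alone does not settle reality, edge lengths and distinctness. Reality: the
  determinant is real on both real forms, so they are closed under inverses. A real factor keeps an
  off-diagonal matrix in its form, while an imaginary factor exchanges the two forms; hence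
  imaginary \<open>lam\<close> in (A) and the factor \<open>\<i>\<close> in (B). Lengths: with
  \<open>s\<close> the determinant of \<open>lam u\<close>, equal to lam^2 eta^2, neighbouring
  points in (A) have inner product (1 - s) / (1 + s). The same involution sends the inner product
  \<open>c\<close> of neighbours in (B) to the determinant of the new edge. For imaginary
  \<open>lam\<close> the bound on |lam| amounts to 1 + s > 0, and this positivity also keeps the
  curve on the sheet of \<open>qk\<close>. Distinctness of points two steps apart concerns two
  adjacent edges. Both transport matrices can be referred to the common vertex, where the condition
  becomes a polynomial identity in the two old edges. In (B) the inner product is known only through
  arccos or arcosh, so it must be bounded before it can be seen to be constant.\<close>

lemma cmat_of_nth [simp]:
  "cmat_of a b c d $ 1 $ 1 = a" "cmat_of a b c d $ 1 $ 2 = b"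
  "cmat_of a b c d $ 2 $ 1 = c" "cmat_of a b c d $ 2 $ 2 = d"
  by (simp_all add: cmat_of_def)

lemma cscale_nth [simp]: "cscale c A $ i $ j = c * A $ i $ j"
  by (simp add: cscale_def)

lemma adjugate_nth [simp]:
  "adjugate A $ 1 $ 1 = A $ 2 $ 2" "adjugate A $ 1 $ 2 = - A $ 1 $ 2"
  "adjugate A $ 2 $ 1 = - A $ 2 $ 1" "adjugate A $ 2 $ 2 = A $ 1 $ 1"
  by (simp_all add: adjugate_def)

lemma mult_nth: "(A ** B) $ i $ j = A $ i $ 1 * B $ 1 $ j + A $ i $ 2 * B $ 2 $ j"
  for A B :: cmat
  by (simp add: matrix_matrix_mult_def sum_2)

lemma one_nth [simp]:
  "(mat 1 :: cmat) $ 1 $ 1 = 1" "(mat 1 :: cmat) $ 1 $ 2 = 0"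
  "(mat 1 :: cmat) $ 2 $ 1 = 0" "(mat 1 :: cmat) $ 2 $ 2 = 1"
  by (simp_all add: mat_def)

lemma trace_cmat: "trace A = A $ 1 $ 1 + A $ 2 $ 2" for A :: cmat
  by (simp add: trace_def sum_2)

lemma cmat_eq_iff:
  "A = B \<longleftrightarrow> A $ 1 $ 1 = B $ 1 $ 1 \<and> A $ 1 $ 2 = B $ 1 $ 2 \<and>
     A $ 2 $ 1 = B $ 2 $ 1 \<and> A $ 2 $ 2 = B $ 2 $ 2" for A B :: cmat
  by (auto simp: vec_eq_iff forall_2)

lemma unit_nth [simp]:
  "qk $ 1 $ 1 = - \<i>" "qk $ 1 $ 2 = 0" "qk $ 2 $ 1 = 0" "qk $ 2 $ 2 = \<i>"
  "qi $ 1 $ 1 = 0" "qi $ 1 $ 2 = - \<i>" "qi $ 2 $ 1 = - \<i>" "qi $ 2 $ 2 = 0"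
  "qj $ 1 $ 1 = 0" "qj $ 1 $ 2 = - 1" "qj $ 2 $ 1 = 1" "qj $ 2 $ 2 = 0"
  "sigma1 $ 1 $ 1 = 0" "sigma1 $ 1 $ 2 = 1" "sigma1 $ 2 $ 1 = 1" "sigma1 $ 2 $ 2 = 0"
  "sigma2 $ 1 $ 1 = 0" "sigma2 $ 1 $ 2 = - \<i>" "sigma2 $ 2 $ 1 = \<i>" "sigma2 $ 2 $ 2 = 0"
  by (simp_all add: qk_def qi_def qj_def sigma1_def sigma2_def sigma3_def)

lemma det_qk [simp]: "det qk = 1"
  by (simp add: det_2)

lemma trace_qk [simp]: "trace qk = 0"
  by (simp add: trace_cmat)

lemma matrix_inv_eqI:
  fixes A B :: cmat
  assumes "A ** B = mat 1"
  shows "matrix_inv A = B"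
proof -
  have "B ** A = mat 1"
    using assms by (simp add: matrix_left_right_inverse)
  then have "invertible A"
    using assms by (auto simp: invertible_def)
  then have "matrix_inv A = matrix_inv A ** (A ** B)"
    using assms by simp
  also have "\<dots> = B"
    using \<open>invertible A\<close> by (simp add: matrix_mul_assoc matrix_inv_works)
  finally show ?thesis .
qed

lemma mult_adjugate: "A ** adjugate A = cscale (det A) (mat 1)"
  by (simp add: cmat_eq_iff mult_nth det_2 algebra_simps)

lemma cscale_mult: "A ** cscale c B = cscale c (A ** B)" "cscale c A ** B = cscale c (A ** B)"
  by (simp_all add: cmat_eq_iff mult_nth algebra_simps)

lemma cscale_eq_0_iff: "cscale c A = 0 \<longleftrightarrow> c = 0 \<or> A = 0"
  by (auto simp: cmat_eq_iff)

lemma det_cscale: "det (cscale c A) = c\<^sup>2 * det A"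
  by (simp add: det_2 power2_eq_square algebra_simps)

lemma cscale_one [simp]: "cscale 1 A = A"
  by (simp add: cmat_eq_iff)

lemma cscale_add: "cscale c (A + B) = cscale c A + cscale c B"
  by (simp add: cmat_eq_iff algebra_simps)

lemma adjugate_mult: "adjugate (A ** B) = adjugate B ** adjugate A"
  by (simp add: cmat_eq_iff mult_nth algebra_simps)

lemma adjugate_minus: "adjugate (- A) = - adjugate A"
  by (simp add: cmat_eq_iff)

lemma adjugate_trace_free: "trace A = 0 \<Longrightarrow> adjugate A = - A"
  by (simp add: cmat_eq_iff trace_cmat eq_neg_iff_add_eq_0 add.commute)

lemma mult_diff: "A ** (B - C) = A ** B - A ** C" "(A - B) ** C = A ** C - B ** C"
  for A B C :: cmat
  by (simp_all add: cmat_eq_iff mult_nth algebra_simps)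

lemma mult_minus: "A ** (- B) = - (A ** B)" "(- A) ** B = - (A ** B)" for A B :: cmat
  by (simp_all add: cmat_eq_iff mult_nth)

lemma matrix_inv_adjugate:
  assumes "det A \<noteq> 0"
  shows "matrix_inv A = cscale (1 / det A) (adjugate A)"
  using assms by (intro matrix_inv_eqI) (simp add: cscale_mult mult_adjugate cmat_eq_iff)

lemma matrix_inv_mult:
  fixes A B :: cmat
  assumes "invertible A" "invertible B"
  shows "matrix_inv (A ** B) = matrix_inv B ** matrix_inv A"
proof (rule matrix_inv_eqI)
  have "A ** B ** (matrix_inv B ** matrix_inv A) = A ** (B ** matrix_inv B) ** matrix_inv A"
    by (simp add: matrix_mul_assoc)
  then show "A ** B ** (matrix_inv B ** matrix_inv A) = mat 1"
    using assms by (simp add: matrix_inv_works)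
qed

lemma det_matrix_inv:
  fixes A :: cmat
  assumes "invertible A"
  shows "det A * det (matrix_inv A) = 1"
  using assms by (metis det_mul det_I matrix_inv_works(1))

lemma det_one_plus: "det (mat 1 + A) = 1 + trace A + det A" for A :: cmat
  by (simp add: det_2 trace_cmat algebra_simps)

lemma det_one_minus: "det (mat 1 - A) = 1 - trace A + det A" for A :: cmat
  by (simp add: det_2 trace_cmat algebra_simps)

lemma mip_self: "mip A A = det A"
  by (simp add: mip_def trace_cmat mult_nth det_2)

text \<open>\<open>A ** adjugate A\<close> is the scalar \<open>det A\<close>, and a matrix and its
  adjugate have the same trace. The distance from a point to the next one is thus read off from the
  trace of the transport matrix.\<close>

lemma mip_left_mult: "mip A (B ** A) = det A * trace B / 2"
  by (simp add: mip_def trace_cmat mult_nth det_2 algebra_simps)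

text \<open>Polarization: \<open>mip\<close> is the symmetric bilinear form of the quadratic form
  \<open>det\<close>.\<close>

lemma det_diff_mip: "det (A - B) = det A + det B - 2 * mip A B"
  by (simp add: mip_def trace_cmat mult_nth det_2 field_simps)

lemma det_add_mip: "det (A + B) = det A + det B + 2 * mip A B"
  by (simp add: mip_def trace_cmat mult_nth det_2 field_simps)

text \<open>Cayley-Hamilton without the linear term. On the sphere and the hyperboloid it gives F^2
  = -1.\<close>

lemma square_trace_free:
  assumes "trace A = 0"
  shows "A ** A = - cscale (det A) (mat 1)"
proof -
  have "A $ 2 $ 2 = - A $ 1 $ 1"
    using assms by (simp add: trace_cmat eq_neg_iff_add_eq_0 add.commute)
  then show ?thesis
    by (simp add: cmat_eq_iff mult_nth det_2 algebra_simps)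
qed

subsection \<open>Conjugation and the Cayley transform\<close>

definition conjugate :: "cmat \<Rightarrow> cmat \<Rightarrow> cmat" where
  "conjugate P X = matrix_inv P ** X ** P"

definition cayley :: "cmat \<Rightarrow> cmat" where
  "cayley A = matrix_inv (mat 1 + A) ** (mat 1 - A)"

lemma conjugate_one [simp]: "conjugate (mat 1) X = X"
proof -
  have "matrix_inv (mat 1) = (mat 1 :: cmat)"
    by (rule matrix_inv_eqI) simp
  then show ?thesis
    by (simp add: conjugate_def)
qed

lemma conjugate_conjugate:
  assumes "invertible A" "invertible B"
  shows "conjugate (A ** B) X = conjugate B (conjugate A X)"
  using assms by (simp add: conjugate_def matrix_inv_mult matrix_mul_assoc)

lemma conjugate_mult:
  assumes "invertible P"
  shows "conjugate P (X ** Y) = conjugate P X ** conjugate P Y"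
proof -
  have "conjugate P X ** conjugate P Y = matrix_inv P ** X ** (P ** matrix_inv P) ** Y ** P"
    by (simp add: conjugate_def matrix_mul_assoc)
  then show ?thesis
    using assms by (simp add: conjugate_def matrix_inv_works matrix_mul_assoc)
qed

lemma conjugate_add: "conjugate P (X + Y) = conjugate P X + conjugate P Y"
  by (simp add: conjugate_def cmat_eq_iff mult_nth algebra_simps)

lemma conjugate_minus: "conjugate P (- X) = - conjugate P X"
  by (simp add: conjugate_def cmat_eq_iff mult_nth algebra_simps)

lemma conjugate_eqD:
  assumes "invertible P" "conjugate P X = conjugate P Y"
  shows "X = Y"
proof -
  have *: "P ** conjugate P Z ** matrix_inv P = Z" for Z
  proof -
    have "P ** conjugate P Z ** matrix_inv P = (P ** matrix_inv P) ** Z ** (P ** matrix_inv P)"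
      by (simp add: conjugate_def matrix_mul_assoc)
    then show ?thesis
      using assms(1) by (simp add: matrix_inv_works)
  qed
  have "X = P ** conjugate P X ** matrix_inv P"
    by (rule * [symmetric])
  also have "\<dots> = Y"
    unfolding assms(2) by (rule *)
  finally show ?thesis .
qed

lemma det_conjugate:
  assumes "invertible P"
  shows "det (conjugate P X) = det X"
  using det_matrix_inv[OF assms] by (simp add: conjugate_def det_mul algebra_simps)

lemma trace_conjugate:
  assumes "invertible P"
  shows "trace (conjugate P X) = trace X"
proof -
  have "trace (conjugate P X) = trace (P ** (matrix_inv P ** X))"
    unfolding conjugate_def by (rule trace_mul_sym)
  then have "trace (conjugate P X) = trace (P ** matrix_inv P ** X)"
    by (simp add: matrix_mul_assoc)
  then show ?thesis
    using assms by (simp add: matrix_inv_works)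
qed

lemma cayley_mult_one_plus:
  assumes "invertible (mat 1 + A)"
  shows "cayley A ** (mat 1 + A) = mat 1 - A"
    and "(mat 1 + A) ** cayley A = mat 1 - A"
proof -
  have "(mat 1 - A) ** (mat 1 + A) = (mat 1 + A) ** (mat 1 - A)"
    by (simp add: cmat_eq_iff mult_nth algebra_simps)
  then have "cayley A ** (mat 1 + A) = matrix_inv (mat 1 + A) ** ((mat 1 + A) ** (mat 1 - A))"
    by (simp add: cayley_def matrix_mul_assoc [symmetric])
  then show "cayley A ** (mat 1 + A) = mat 1 - A"
    using assms by (simp add: matrix_mul_assoc matrix_inv_works)
  show "(mat 1 + A) ** cayley A = mat 1 - A"
    using assms by (simp add: cayley_def matrix_mul_assoc matrix_inv_works)
qed

text \<open>\<open>cayley A\<close> is a rational function of \<open>A\<close> and therefore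
  commutes with \<open>mat 1 + A\<close>.\<close>

lemma conjugate_cayley:
  assumes "invertible (mat 1 + A)"
  shows "conjugate (mat 1 + A) (cayley A) = cayley A"
proof -
  have "conjugate (mat 1 + A) (cayley A) = matrix_inv (mat 1 + A) ** (cayley A ** (mat 1 + A))"
    by (simp add: conjugate_def matrix_mul_assoc)
  then show ?thesis
    unfolding cayley_mult_one_plus(1)[OF assms] by (simp add: cayley_def)
qed

text \<open>Expanding \<open>adjugate (mat 1 + A) ** (mat 1 - A)\<close> separates the scalar part
  from the trace-free part \<open>adjugate A - A\<close>, so that trace and vanishing of the scalar
  part become visible.\<close>

lemma cayley_adjugate:
  assumes "invertible (mat 1 + A)"
  shows "cayley A =
    cscale (1 / det (mat 1 + A)) (cscale (1 - det A) (mat 1) + (adjugate A - A))"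
proof -
  have "adjugate (mat 1 + A) ** (mat 1 - A) = cscale (1 - det A) (mat 1) + (adjugate A - A)"
    by (simp add: cmat_eq_iff mult_nth det_2 algebra_simps)
  then show ?thesis
    using assms by (simp add: cayley_def matrix_inv_adjugate invertible_det_nz cscale_mult)
qed

lemma trace_cayley:
  assumes "invertible (mat 1 + A)"
  shows "trace (cayley A) = 2 * (1 - det A) / det (mat 1 + A)"
  unfolding cayley_adjugate[OF assms] by (simp add: trace_cmat algebra_simps flip: add_divide_distrib diff_divide_distrib)

lemma cayley_det_one:
  assumes "det A = 1" "invertible (mat 1 + A)"
  shows "cayley A = cscale (1 / det (mat 1 + A)) (adjugate A - A)"
  unfolding cayley_adjugate[OF assms(2)] assms(1) by (simp add: cmat_eq_iff)

lemma det_cayley: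
  assumes "invertible (mat 1 + A)"
  shows "det (cayley A) = det (mat 1 - A) / det (mat 1 + A)"
proof -
  have "det (cayley A) * det (mat 1 + A) = det (mat 1 - A)"
    by (simp add: cayley_mult_one_plus(1)[OF assms] flip: det_mul)
  then show ?thesis
    using assms by (simp add: invertible_det_nz eq_divide_eq)
qed

text \<open>\<open>qk\<close> is diagonal with nonzero entries, so anticommuting with it doubles
  each diagonal entry of \<open>X\<close> to zero.\<close>

lemma anticommuting_qk_nth:
  assumes "X ** qk = - (qk ** X)"
  shows "X $ 1 $ 1 = 0" "X $ 2 $ 2 = 0"
  using assms by (simp_all add: cmat_eq_iff mult_nth)

text \<open>For \<open>\<epsilon> = 1\<close> these are the quaternions, for \<open>\<epsilon> = - 1\<close> the split quaternions.\<close>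

definition real_form :: "real \<Rightarrow> cmat set" where
  "real_form \<epsilon> = {A. A $ 2 $ 2 = cnj (A $ 1 $ 1) \<and> A $ 2 $ 1 = - of_real \<epsilon> * cnj (A $ 1 $ 2)}"

lemma real_form_one [simp]: "mat 1 \<in> real_form \<epsilon>"
  by (simp add: real_form_def)

lemma real_form_qk [simp]: "qk \<in> real_form \<epsilon>"
  by (simp add: real_form_def)

lemma real_form_add: "A \<in> real_form \<epsilon> \<Longrightarrow> B \<in> real_form \<epsilon> \<Longrightarrow> A + B \<in> real_form \<epsilon>"
  by (simp add: real_form_def algebra_simps)

lemma real_form_diff: "A \<in> real_form \<epsilon> \<Longrightarrow> B \<in> real_form \<epsilon> \<Longrightarrow> A - B \<in> real_form \<epsilon>"
  by (simp add: real_form_def algebra_simps)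

lemma real_form_mult: "A \<in> real_form \<epsilon> \<Longrightarrow> B \<in> real_form \<epsilon> \<Longrightarrow> A ** B \<in> real_form \<epsilon>"
  by (simp add: real_form_def mult_nth algebra_simps)

lemma real_form_det:
  "A \<in> real_form \<epsilon> \<Longrightarrow> det A = of_real ((cmod (A $ 1 $ 1))\<^sup>2 + \<epsilon> * (cmod (A $ 1 $ 2))\<^sup>2)"
  by (simp add: real_form_def det_2 complex_norm_square algebra_simps del: of_real_power)

lemma real_form_matrix_inv:
  assumes "A \<in> real_form \<epsilon>" "invertible A"
  shows "matrix_inv A \<in> real_form \<epsilon>"
proof -
  have "det A \<noteq> 0"
    using assms by (simp add: invertible_det_nz)
  \<comment> \<open>The factor 1 / det in the inverse is real; a genuinely complex factor would
    break the conjugation symmetry of the entries.\<close>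
  moreover obtain r where "det A = of_real r"
    using real_form_det[OF assms(1)] by blast
  ultimately show ?thesis
    using assms(1) by (simp add: matrix_inv_adjugate real_form_def)
qed

lemma real_form_conjugate:
  "P \<in> real_form \<epsilon> \<Longrightarrow> invertible P \<Longrightarrow> X \<in> real_form \<epsilon> \<Longrightarrow> conjugate P X \<in> real_form \<epsilon>"
  by (simp add: conjugate_def real_form_mult real_form_matrix_inv)

lemma real_form_cayley:
  "A \<in> real_form \<epsilon> \<Longrightarrow> invertible (mat 1 + A) \<Longrightarrow> cayley A \<in> real_form \<epsilon>"
  by (simp add: cayley_def real_form_mult real_form_matrix_inv real_form_add real_form_diff)

section \<open>The models\<close>

text \<open>The spans are replaced by entry conditions inside \<open>real_form\<close>, whose
  closure under products and inverses then carries all reality arguments.\<close>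

lemma span_qi_qj: "span {qi, qj} = {A \<in> real_form 1. A $ 1 $ 1 = 0}"
proof (intro equalityI subsetI)
  fix A assume "A \<in> span {qi, qj}"
  then obtain x y where "A = x *\<^sub>R qi + y *\<^sub>R qj"
    by (auto simp: span_breakdown_eq algebra_simps)
  then show "A \<in> {A \<in> real_form 1. A $ 1 $ 1 = 0}"
    by (simp add: real_form_def)
next
  fix A assume "A \<in> {A \<in> real_form 1. A $ 1 $ 1 = 0}"
  \<comment> \<open>The upper right entries of \<open>qi\<close> and \<open>qj\<close> are
    \<open>- \<i>\<close> and -1, hence the signs and the exchange of real and imaginary
    part.\<close>
  then have "A = (- Im (A $ 1 $ 2)) *\<^sub>R qi + (- Re (A $ 1 $ 2)) *\<^sub>R qj"
    by (simp add: real_form_def cmat_eq_iff complex_eq_iff)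
  then show "A \<in> span {qi, qj}"
    by (rule ssubst) (intro span_add span_scale span_base; simp)
qed

lemma span_qi_qj_qk: "span {qi, qj, qk} = {A \<in> real_form 1. trace A = 0}"
proof (intro equalityI subsetI)
  fix A assume "A \<in> span {qi, qj, qk}"
  then obtain x y z where "A = x *\<^sub>R qi + y *\<^sub>R qj + z *\<^sub>R qk"
    by (auto simp: span_breakdown_eq algebra_simps)
  then show "A \<in> {A \<in> real_form 1. trace A = 0}"
    by (simp add: real_form_def trace_cmat complex_eq_iff)
next
  fix A assume "A \<in> {A \<in> real_form 1. trace A = 0}"
  then have "A = (- Im (A $ 1 $ 2)) *\<^sub>R qi + (- Re (A $ 1 $ 2)) *\<^sub>R qj + (- Im (A $ 1 $ 1)) *\<^sub>R qk"
    by (simp add: real_form_def cmat_eq_iff complex_eq_iff trace_cmat)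
  then show "A \<in> span {qi, qj, qk}"
    by (rule ssubst) (intro span_add span_scale span_base; simp)
qed

lemma trace_free_split_expansion:
  assumes "A \<in> real_form (- 1)" "trace A = 0"
  shows "A = Re (A $ 1 $ 2) *\<^sub>R sigma1 + (- Im (A $ 1 $ 2)) *\<^sub>R sigma2 + (- Im (A $ 1 $ 1)) *\<^sub>R qk"
  using assms by (simp add: real_form_def cmat_eq_iff complex_eq_iff trace_cmat)

lemma span_sigma1_sigma2_qk: "span {sigma1, sigma2, qk} = {A \<in> real_form (- 1). trace A = 0}"
proof (intro equalityI subsetI)
  fix A assume "A \<in> span {sigma1, sigma2, qk}"
  then obtain x y z where "A = x *\<^sub>R sigma1 + y *\<^sub>R sigma2 + z *\<^sub>R qk"
    by (auto simp: span_breakdown_eq algebra_simps)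
  then show "A \<in> {A \<in> real_form (- 1). trace A = 0}"
    by (simp add: real_form_def trace_cmat complex_eq_iff)
next
  fix A assume "A \<in> {A \<in> real_form (- 1). trace A = 0}"
  then have "A = Re (A $ 1 $ 2) *\<^sub>R sigma1 + (- Im (A $ 1 $ 2)) *\<^sub>R sigma2 + (- Im (A $ 1 $ 1)) *\<^sub>R qk"
    by (intro trace_free_split_expansion) auto
  then show "A \<in> span {sigma1, sigma2, qk}"
    by (rule ssubst) (intro span_add span_scale span_base; simp)
qed

text \<open>\<open>sigma1\<close> and \<open>sigma2\<close> have zero diagonal, so the
  \<open>qk\<close> coordinate is determined by the upper left entry. This turns the sheets into
  sign conditions on one entry.\<close>

lemma split_coordinate_iff:
  assumes "A \<in> model Hyperbolic"
  shows "(\<exists>a b c. A = a *\<^sub>R sigma1 + b *\<^sub>R sigma2 + c *\<^sub>R qk \<and> P c) \<longleftrightarrow> P (- Im (A $ 1 $ 1))"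
proof
  assume "\<exists>a b c. A = a *\<^sub>R sigma1 + b *\<^sub>R sigma2 + c *\<^sub>R qk \<and> P c"
  then show "P (- Im (A $ 1 $ 1))"
    by auto
next
  assume "P (- Im (A $ 1 $ 1))"
  moreover have "A = Re (A $ 1 $ 2) *\<^sub>R sigma1 + (- Im (A $ 1 $ 2)) *\<^sub>R sigma2 + (- Im (A $ 1 $ 1)) *\<^sub>R qk"
    using assms by (intro trace_free_split_expansion) (auto simp: span_sigma1_sigma2_qk)
  ultimately show "\<exists>a b c. A = a *\<^sub>R sigma1 + b *\<^sub>R sigma2 + c *\<^sub>R qk \<and> P c"
    by blast
qed

lemma upper_sheet_iff: "A \<in> upper_sheet \<longleftrightarrow> A \<in> model Hyperbolic \<and> Im (A $ 1 $ 1) < 0"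
  unfolding upper_sheet_def using split_coordinate_iff[of A "\<lambda>c. c > 0"]
  by (auto simp del: model.simps)

lemma lower_sheet_iff: "A \<in> lower_sheet \<longleftrightarrow> A \<in> model Hyperbolic \<and> Im (A $ 1 $ 1) > 0"
  unfolding lower_sheet_def using split_coordinate_iff[of A "\<lambda>c. c < 0"]
  by (auto simp del: model.simps)

section \<open>Curves determined by their transport matrix\<close>

lemma int_constant:
  fixes f :: "int \<Rightarrow> 'a"
  assumes "\<And>t. f (t + 1) = f t"
  shows "f t = f t0"
proof (induction t rule: int_induct[where k = t0])
  case (step2 i)
  then show ?case
    using assms[of "i - 1"] by simp
qed (simp_all add: assms)

text \<open>A candidate \<open>G\<close> that is already known to be invertible makes every
  \<open>u t\<close> invertible, and then the recursion has a unique solution in both directions of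
  time.\<close>

lemma curve_of_multiplicative:
  assumes Q: "Q \<noteq> Euclidean"
    and inv: "\<And>t. invertible (G t)" and init: "G t0 = qk"
    and step: "\<And>t. G (t + 1) = u t ** G t"
  shows "\<exists>!F. determined_by Q t0 u F" and "curve_of Q t0 u = G"
proof -
  have tr: "transport Q F t = F (t + 1) ** matrix_inv (F t)" for F t
    using Q by (cases Q) auto
  have base: "base_point Q = qk"
    using Q by (cases Q) auto
  have u: "u t = G (t + 1) ** matrix_inv (G t)" for t
    by (simp add: step matrix_inv_works(1)[OF inv] flip: matrix_mul_assoc)
  have inv_inv: "invertible (matrix_inv (G t))" for t
    using matrix_inv_works[OF inv[of t]] by (auto simp: invertible_def)
  have inv_u: "invertible (u t)" for t
    unfolding u by (intro invertible_mult inv inv_inv)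
  have G: "determined_by Q t0 u G"
    by (simp add: determined_by_def base tr init inv u)
  moreover have "F = G" if F: "determined_by Q t0 u F" for F
  proof -
    have "F (t + 1) = u t ** F t" for t
    proof -
      have "invertible (F t)" "F (t + 1) ** matrix_inv (F t) = u t"
        using F Q by (auto simp: determined_by_def tr)
      then show ?thesis
        by (metis matrix_inv_works(2) matrix_mul_assoc matrix_mul_rid)
    qed
    moreover have "F t0 = qk"
      using F by (simp add: determined_by_def base)
    ultimately show ?thesis
      using matrix_recursion_ex1[of u t0 qk, OF inv_u] init step by blast
  qed
  ultimately show ex1: "\<exists>!F. determined_by Q t0 u F"
    by blast
  show "curve_of Q t0 u = G"
    using ex1 G unfolding curve_of_def by (simp add: the1_equality)
qed

lemma additive_recursion_ex1:
  fixes w :: "int \<Rightarrow> 'a :: ab_group_add"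
  shows "\<exists>!F. F t0 = 0 \<and> (\<forall>t. F (t + 1) - F t = w t)"
proof -
  \<comment> \<open>One of the two intervals is always empty, so a single formula serves both sides
    of \<open>t0\<close>.\<close>
  define F where "F t = (\<Sum>s\<in>{t0..<t}. w s) - (\<Sum>s\<in>{t..<t0}. w s)" for t
  have "F (t + 1) - F t = w t" for t
  proof (cases "t0 \<le> t")
    case True
    then have "{t0..<t + 1} = insert t {t0..<t}" "{t..<t0} = {}" "{t + 1..<t0} = {}"
      by auto
    then show ?thesis
      by (simp add: F_def)
  next
    case False
    then have "{t..<t0} = insert t {t + 1..<t0}" "{t0..<t} = {}" "{t0..<t + 1} = {}"
      by auto
    then show ?thesis
      by (simp add: F_def)
  qed
  moreover have "F t0 = 0"
    by (simp add: F_def)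
  moreover have "R = S" if "R t0 = 0 \<and> (\<forall>t. R (t + 1) - R t = w t)"
    and "S t0 = 0 \<and> (\<forall>t. S (t + 1) - S t = w t)" for R S
  proof
    fix t
    have "R (t + 1) - S (t + 1) = R t - S t" for t
      using that by (metis add_diff_cancel_left diff_add_cancel)
    then have "R t - S t = R t0 - S t0"
      by (rule int_constant)
    then show "R t = S t"
      using that by simp
  qed
  ultimately show ?thesis
    by (intro ex1I[of _ F]) blast+
qed

text \<open>For a plane curve everything is visible on the edges: \<open>d\<close> is the squared
  edge length, \<open>d \<noteq> 0\<close> separates neighbours, and a sum of two adjacent edges is
  the difference of points two steps apart.\<close>

lemma defines_curve_Euclidean:
  assumes w: "\<And>t. w t \<in> model Euclidean"
    and det: "\<And>t. det (w t) = d" and "d \<noteq> 0"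
    and nz: "\<And>t. w t + w (t + 1) \<noteq> 0"
  shows "defines_curve Euclidean t0 w"
proof -
  have ex1: "\<exists>!F. determined_by Euclidean t0 w F"
    using additive_recursion_ex1[of t0 w] by (simp add: determined_by_def)
  define F where "F = curve_of Euclidean t0 w"
  have "determined_by Euclidean t0 w F"
    unfolding F_def curve_of_def using ex1 by (rule theI')
  then have F0: "F t0 = 0" and diff: "\<And>t. F (t + 1) - F t = w t"
    by (simp_all add: determined_by_def)
  have "F t \<in> model Euclidean" for t
  proof (induction t rule: int_induct[where k = t0])
    case base
    then show ?case
      by (simp add: F0 span_zero)
  next
    case (step1 i)
    have "F (i + 1) = F i + w i"
      using diff[of i] by (simp add: algebra_simps)
    then show ?case
      using step1 w[of i] by (simp add: span_add)
  next
    case (step2 i)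
    have "F (i - 1) = F i - w (i - 1)"
      using diff[of "i - 1"] by (simp add: algebra_simps)
    then show ?case
      using step2 w[of "i - 1"] by (simp add: span_diff)
  qed
  moreover have "F t \<noteq> F (t + 1)" for t
    using diff[of t] det[of t] \<open>d \<noteq> 0\<close> by (auto simp: det_2)
  moreover have "F t \<noteq> F (t + 2)" for t
    using diff[of t] diff[of "t + 1"] nz[of t] by (auto simp: algebra_simps)
  moreover have "model_dist Euclidean (F t) (F (t + 1)) = sqrt (Re d)" for t
    by (simp add: diff mip_self det)
  ultimately have "F \<in> curves Euclidean"
    unfolding curves_def by (simp add: add.assoc) (metis add.assoc one_add_one)
  then show ?thesis
    using ex1 by (simp add: defines_curve_def F_def)
qed

section \<open>The associated map\<close>

lemma assoc_map_invertible:
  assumes "admissible lam u"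
  shows "invertible (assoc_map t0 lam u t)"
proof (induction t rule: int_induct[where k = t0])
  case base
  show ?case
    by (simp add: assoc_map_rec[OF assms] invertible_det_nz)
next
  case (step1 i)
  then show ?case
    using assms by (simp add: assoc_map_rec[OF assms] admissible_def invertible_mult)
next
  case (step2 i)
  have "assoc_map t0 lam u i = (mat 1 + cscale lam (u (i - 1))) ** assoc_map t0 lam u (i - 1)"
    using assoc_map_rec(2)[OF assms, of t0 "i - 1"] by simp
  then show ?case
    using step2 by (auto simp: invertible_det_nz det_mul)
qed

lemma assoc_map_real_form:
  assumes adm: "admissible lam u" and "\<And>t. cscale lam (u t) \<in> real_form \<epsilon>"
  shows "assoc_map t0 lam u t \<in> real_form \<epsilon>"
proof (induction t rule: int_induct[where k = t0])
  case base
  show ?case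
    by (simp add: assoc_map_rec[OF adm])
next
  case (step1 i)
  then show ?case
    using assms by (simp add: assoc_map_rec[OF adm] real_form_mult real_form_add)
next
  case (step2 i)
  define S where "S = mat 1 + cscale lam (u (i - 1))"
  have S: "invertible S" "S \<in> real_form \<epsilon>"
    using assms by (simp_all add: S_def admissible_def real_form_add)
  have "assoc_map t0 lam u i = S ** assoc_map t0 lam u (i - 1)"
    using assoc_map_rec(2)[OF adm, of t0 "i - 1"] by (simp add: S_def)
  then have "assoc_map t0 lam u (i - 1) = matrix_inv S ** assoc_map t0 lam u i"
    by (simp add: matrix_mul_assoc matrix_inv_works(2)[OF S(1)])
  then show ?case
    using step2 S by (simp add: real_form_mult real_form_matrix_inv)
qed

text \<open>The new factor stands to the left of the old map and so acts first under conjugation.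
  Comparing neighbouring vertices thus needs only \<open>mat 1 + cscale lam (u t)\<close>.\<close>

lemma conjugate_assoc_map_step:
  assumes adm: "admissible lam u"
  shows "conjugate (assoc_map t0 lam u (t + 1)) X =
    conjugate (assoc_map t0 lam u t) (conjugate (mat 1 + cscale lam (u t)) X)"
  using assms
  by (simp add: assoc_map_rec(2) conjugate_conjugate assoc_map_invertible admissible_def)

text \<open>Having both forms allows two adjacent edges to be conjugated by the same map, that of
  their common vertex.\<close>

lemma assoc_transport_eq_conjugate_cayley:
  assumes adm: "admissible lam u"
  shows "assoc_transport t0 lam u t = conjugate (assoc_map t0 lam u t) (cayley (cscale lam (u t)))"
    and "assoc_transport t0 lam u t = conjugate (assoc_map t0 lam u (t + 1)) (cayley (cscale lam (u t)))"
proof -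
  have S: "invertible (mat 1 + cscale lam (u t))"
    using adm by (simp add: admissible_def)
  show eq: "assoc_transport t0 lam u t = conjugate (assoc_map t0 lam u t) (cayley (cscale lam (u t)))"
    using S by (simp add: assoc_transport_def assoc_map_rec(2)[OF adm] matrix_inv_mult
        assoc_map_invertible[OF adm] conjugate_def cayley_def matrix_mul_assoc)
  show "assoc_transport t0 lam u t = conjugate (assoc_map t0 lam u (t + 1)) (cayley (cscale lam (u t)))"
    by (simp add: eq conjugate_assoc_map_step[OF adm] conjugate_cayley[OF S])
qed

text \<open>Clearing denominators leaves (1 + A)(1 + B) = (1 - A)(1 - B), in which the term AB
  cancels. It excludes returning after two steps in (A).\<close>

lemma mult_cayley_eq_one:
  assumes "invertible (mat 1 + A)" "invertible (mat 1 + B)" "cayley A ** cayley B = mat 1"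
  shows "A + B = 0"
proof -
  have "(mat 1 + A) ** (mat 1 + B) = (mat 1 + A) ** (cayley A ** cayley B) ** (mat 1 + B)"
    by (simp add: assms(3))
  also have "\<dots> = ((mat 1 + A) ** cayley A) ** (cayley B ** (mat 1 + B))"
    by (simp add: matrix_mul_assoc)
  also have "\<dots> = (mat 1 - A) ** (mat 1 - B)"
    by (simp only: cayley_mult_one_plus[OF assms(1)] cayley_mult_one_plus[OF assms(2)])
  finally have "(mat 1 + A) ** (mat 1 + B) - (mat 1 - A) ** (mat 1 - B) = 0"
    by simp
  moreover have "(mat 1 + A) ** (mat 1 + B) - (mat 1 - A) ** (mat 1 - B) = cscale 2 (A + B)"
    by (simp add: cmat_eq_iff mult_nth algebra_simps)
  ultimately show ?thesis
    by (simp add: cscale_eq_0_iff)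
qed

text \<open>Counterpart for (B): after clearing denominators the linear terms cancel, and the
  quadratic one remains.\<close>

lemma cayley_add_eq_zero:
  assumes "invertible (mat 1 + A)" "invertible (mat 1 + B)" "cayley A + cayley B = 0"
  shows "A ** B = mat 1"
proof -
  have "(mat 1 + A) ** (cayley A + cayley B) ** (mat 1 + B) =
      ((mat 1 + A) ** cayley A) ** (mat 1 + B) + (mat 1 + A) ** (cayley B ** (mat 1 + B))"
    by (simp add: matrix_add_ldistrib matrix_mul_assoc) (simp add: cmat_eq_iff mult_nth algebra_simps)
  also have "\<dots> = (mat 1 - A) ** (mat 1 + B) + (mat 1 + A) ** (mat 1 - B)"
    by (simp only: cayley_mult_one_plus[OF assms(1)] cayley_mult_one_plus[OF assms(2)])
  also have "\<dots> = cscale 2 (mat 1 - A ** B)"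
    by (simp add: cmat_eq_iff mult_nth algebra_simps)
  finally have "cscale 2 (mat 1 - A ** B) = (mat 1 + A) ** 0 ** (mat 1 + B)"
    by (simp add: assms(3))
  also have "\<dots> = 0"
    by (simp add: cmat_eq_iff mult_nth)
  finally show ?thesis
    by (simp add: cscale_eq_0_iff)
qed

section \<open>From plane curves to curves on the sphere and the hyperboloid\<close>

lemma conjugate_one_plus_qk:
  assumes "A $ 1 $ 1 = 0" "A $ 2 $ 2 = 0"
  shows "conjugate (mat 1 + A) qk = cayley A ** qk"
proof -
  have "qk ** (mat 1 + A) = (mat 1 - A) ** qk"
    using assms by (simp add: cmat_eq_iff mult_nth)
  then show ?thesis
    by (simp add: conjugate_def cayley_def flip: matrix_mul_assoc)
qed

text \<open>The upper left entry is \<open>- \<i>\<close> times |a|^2 + |b|^2 over \<open>r\<close>,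
  with a and b the first row of \<open>P\<close>. Split quaternions of positive determinant thus
  preserve the sheet of \<open>qk\<close>.\<close>

lemma Im_conjugate_qk:
  assumes P: "P \<in> real_form (- 1)" and det: "det P = of_real r" and r: "r > 0"
  shows "Im (conjugate P qk $ 1 $ 1) < 0"
proof -
  have "of_real r = complex_of_real ((cmod (P $ 1 $ 1))\<^sup>2 + - 1 * (cmod (P $ 1 $ 2))\<^sup>2)"
    using real_form_det[OF P] det by simp
  then have "r = (cmod (P $ 1 $ 1))\<^sup>2 + - 1 * (cmod (P $ 1 $ 2))\<^sup>2"
    by (simp only: of_real_eq_iff)
  then have pos: "(cmod (P $ 1 $ 1))\<^sup>2 + (cmod (P $ 1 $ 2))\<^sup>2 > 0"
    using r by (smt (verit) zero_le_power2)
  have "conjugate P qk $ 1 $ 1 =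
      (1 / of_real r) * (- \<i> * (P $ 1 $ 1 * cnj (P $ 1 $ 1) + P $ 1 $ 2 * cnj (P $ 1 $ 2)))"
    using P r unfolding conjugate_def
    by (simp add: matrix_inv_adjugate det mult_nth real_form_def algebra_simps)
  also have "\<dots> = of_real (- ((cmod (P $ 1 $ 1))\<^sup>2 + (cmod (P $ 1 $ 2))\<^sup>2) / r) * \<i>"
    by (simp add: complex_norm_square algebra_simps add_divide_distrib diff_divide_distrib del: of_real_power)
  finally show ?thesis
    using pos r by (simp add: divide_less_0_iff)
qed

lemma off_diagonal_det:
  assumes "A \<in> real_form \<epsilon>" "A $ 1 $ 1 = 0"
  shows "trace A = 0" "det (mat 1 + A) = 1 + det A" "det (mat 1 - A) = 1 + det A"
  using assms by (simp_all add: real_form_def trace_cmat det_one_plus det_one_minus)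

text \<open>Both determinants are 1 + s because an off-diagonal matrix has no trace. For imaginary
  \<open>lam\<close> the hypothesis 1 + s > 0 is where the bound on |lam| enters.\<close>

lemma admissible_off_diagonal:
  assumes "\<And>t. cscale lam (u t) \<in> real_form \<epsilon>" "\<And>t. cscale lam (u t) $ 1 $ 1 = 0"
    and "\<And>t. det (cscale lam (u t)) = of_real s" "1 + s > 0"
  shows "admissible lam u"
proof -
  have "1 + complex_of_real s \<noteq> 0"
    using assms(4) by (metis less_irrefl of_real_1 of_real_add of_real_eq_0_iff)
  then show ?thesis
    by (simp add: admissible_def invertible_det_nz off_diagonal_det[OF assms(1,2)] assms(3))
qed

text \<open>Common core of both cases of (A), which differ only in \<epsilon>. Conjugates of
  \<open>qk\<close> keep its trace and determinant, and the inner product of neighbours is half the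
  trace of a Cayley transform, which depends on \<open>s\<close> alone. The positive determinant of
  \<open>\<Phi>\<close> is recorded for the choice of sheet.\<close>

lemma conjugate_assoc_map_qk:
  fixes t0 :: int and lam :: complex and u :: "int \<Rightarrow> cmat"
  defines "\<Phi> \<equiv> assoc_map t0 lam u"
  defines "G \<equiv> \<lambda>t. conjugate (\<Phi> t) qk"
  assumes form: "\<And>t. cscale lam (u t) \<in> real_form \<epsilon>"
    and diag: "\<And>t. cscale lam (u t) $ 1 $ 1 = 0"
    and det: "\<And>t. det (cscale lam (u t)) = of_real s" and s: "s \<noteq> 0" "1 + s > 0"
    and nz: "\<And>t. cscale lam (u t) + cscale lam (u (t + 1)) \<noteq> 0"
  shows "G t0 = qk"
    and "invertible (G t)"
    and "G (t + 1) = assoc_transport t0 lam u t ** G t"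
    and "G t \<in> real_form \<epsilon>" and "trace (G t) = 0" and "det (G t) = 1"
    and "mip (G t) (G (t + 1)) = of_real ((1 - s) / (1 + s))"
    and "G t \<noteq> G (t + 2)"
    and "\<exists>r>0. det (\<Phi> t) = of_real r"
proof -
  define w where "w t = cscale lam (u t)" for t
  have w11: "w t $ 1 $ 1 = 0" for t
    using diag by (simp add: w_def)
  have w22: "w t $ 2 $ 2 = 0" for t
    using form[of t] w11[of t] by (simp add: real_form_def w_def)
  have det_plus: "det (mat 1 + w t) = of_real (1 + s)" for t
    using off_diagonal_det(2)[OF form diag] det by (simp add: w_def)
  have adm: "admissible lam u"
    using form diag det s(2) by (rule admissible_off_diagonal)
  have inv_plus: "invertible (mat 1 + w t)" for t
    using adm by (simp add: admissible_def w_def)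
  note inv = assoc_map_invertible[OF adm, of t0, folded \<Phi>_def]
  have step: "G (t + 1) = conjugate (\<Phi> t) (conjugate (mat 1 + w t) qk)" for t
    unfolding G_def \<Phi>_def w_def by (rule conjugate_assoc_map_step[OF adm])
  show "G t0 = qk"
    by (simp add: G_def \<Phi>_def assoc_map_rec[OF adm])
  show detG: "det (G t) = 1" for t
    by (simp add: G_def det_conjugate[OF inv])
  then show "invertible (G t)"
    by (simp add: invertible_det_nz)
  show "trace (G t) = 0"
    by (simp add: G_def trace_conjugate[OF inv])
  show "G t \<in> real_form \<epsilon>"
    using assoc_map_real_form[OF adm form, of t0 t]
    unfolding G_def by (intro real_form_conjugate inv) (auto simp: \<Phi>_def)
  have U: "assoc_transport t0 lam u t = conjugate (\<Phi> t) (cayley (w t))"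
    and U': "assoc_transport t0 lam u t = conjugate (\<Phi> (t + 1)) (cayley (w t))" for t
    using assoc_transport_eq_conjugate_cayley[OF adm] unfolding \<Phi>_def w_def by auto
  show tr: "G (t + 1) = assoc_transport t0 lam u t ** G t" for t
    unfolding step unfolding U conjugate_one_plus_qk[OF w11 w22] G_def by (rule conjugate_mult[OF inv])
  have "trace (cayley (w t)) = 2 * of_real ((1 - s) / (1 + s))"
    unfolding trace_cayley[OF inv_plus] det_plus using det[of t] by (simp add: w_def)
  then show "mip (G t) (G (t + 1)) = of_real ((1 - s) / (1 + s))"
    by (simp only: tr mip_left_mult detG U trace_conjugate[OF inv] mult_1)
      (rule nonzero_mult_div_cancel_left, simp)
  show "G t \<noteq> G (t + 2)"
  proof
    assume eq: "G t = G (t + 2)"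
    \<comment> \<open>Both transport matrices are viewed from the middle vertex
      \<open>t + 1\<close>, so that one conjugation can be cancelled from the whole
      equation.\<close>
    have "conjugate (\<Phi> (t + 1)) (cayley (w t) ** (cayley (w (t + 1)) ** qk)) =
        assoc_transport t0 lam u t ** (assoc_transport t0 lam u (t + 1) ** G (t + 1))"
      unfolding conjugate_mult[OF inv] U'[of t] U[of "t + 1"] G_def ..
    also have "\<dots> = assoc_transport t0 lam u t ** G t"
      using eq tr[of "t + 1"] by (simp add: add.assoc)
    also have "\<dots> = conjugate (\<Phi> (t + 1)) qk"
      using tr[of t] by (simp only: G_def)
    finally have "cayley (w t) ** (cayley (w (t + 1)) ** qk) = qk"
      by (rule conjugate_eqD[OF inv])
    then have "cayley (w t) ** cayley (w (t + 1)) ** qk ** matrix_inv qk = qk ** matrix_inv qk"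
      by (simp add: matrix_mul_assoc)
    moreover have "qk ** matrix_inv qk = mat 1"
      by (intro matrix_inv_works) (simp add: invertible_det_nz)
    ultimately have "cayley (w t) ** cayley (w (t + 1)) = mat 1"
      by (simp flip: matrix_mul_assoc)
    then have "w t + w (t + 1) = 0"
      by (intro mult_cayley_eq_one inv_plus)
    then show False
      using nz[of t] by (simp add: w_def)
  qed
  have det_step: "det (\<Phi> (t + 1)) = of_real (1 + s) * det (\<Phi> t)" for t
    using det_plus[of t] by (simp add: \<Phi>_def assoc_map_rec(2)[OF adm] det_mul w_def)
  show "\<exists>r>0. det (\<Phi> t) = of_real r"
  proof (induction t rule: int_induct[where k = t0])
    case base
    show ?case
      by (rule exI[of _ 1]) (simp add: \<Phi>_def assoc_map_rec[OF adm])
  next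
    case (step1 i)
    then obtain r where "r > 0" "det (\<Phi> i) = of_real r"
      by blast
    then show ?case
      using s det_step[of i] by (intro exI[of _ "(1 + s) * r"]) simp
  next
    case (step2 i)
    then obtain r where r: "r > 0" "det (\<Phi> i) = of_real r"
      by blast
    have "of_real (1 + s) \<noteq> (0 :: complex)"
      using s by (simp only: of_real_eq_0_iff)
    then have "det (\<Phi> (i - 1)) = of_real (r / (1 + s))"
      using r det_step[of "i - 1"] by (simp add: field_simps)
    then show ?case
      using s r by (intro exI[of _ "r / (1 + s)"]) simp
  qed
qed

text \<open>For points of determinant 1, inner product 1 would arise from equal neighbours and -1
  from antipodal ones.\<close>

lemma ratio_neq_one:
  fixes s :: real
  assumes "s \<noteq> 0" "1 + s > 0"
  shows "(1 - s) / (1 + s) \<noteq> 1" "(1 - s) / (1 + s) \<noteq> - 1"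
  using assms by (simp_all add: field_simps)

lemma plane_to_sphere:
  assumes form: "\<And>t. cscale lam (u t) \<in> real_form 1"
    and diag: "\<And>t. cscale lam (u t) $ 1 $ 1 = 0"
    and det: "\<And>t. det (cscale lam (u t)) = of_real s" and s: "s \<noteq> 0" "1 + s > 0"
    and nz: "\<And>t. cscale lam (u t) + cscale lam (u (t + 1)) \<noteq> 0"
  shows "admissible lam u \<and> defines_curve Spherical t0 (assoc_transport t0 lam u) \<and>
    (\<forall>t. curve_of Spherical t0 (assoc_transport t0 lam u) t =
       matrix_inv (assoc_map t0 lam u t) ** qk ** assoc_map t0 lam u t)"
proof -
  define G where "G t = conjugate (assoc_map t0 lam u t) qk" for t
  note G = conjugate_assoc_map_qk[where lam = lam and u = u and ?t0.0 = t0,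
      OF form diag det s nz, folded G_def]
  have adm: "admissible lam u"
    using form diag det s(2) by (rule admissible_off_diagonal)
  have det1: "mip (G t) (G t) = 1" for t
    using G(6) by (simp add: mip_self)
  have "mip (G t) (- G t) = - mip (G t) (G t)" for t
    by (simp add: mip_def trace_cmat mult_nth field_simps)
  then have "G (t + 1) \<noteq> - G t" for t
    using G(7)[of t] ratio_neq_one(2)[OF s] det1
    by (metis of_real_1 of_real_eq_iff of_real_minus)
  moreover have *: "G t \<noteq> G (t + 1)" for t
    using G(7)[of t] ratio_neq_one(1)[OF s] det1 by (metis of_real_1 of_real_eq_iff)
  moreover have "G (t + 1) \<noteq> G (t + 2)" for t
    using *[of "t + 1"] by (simp add: add.assoc)
  moreover have "\<exists>d. \<forall>t. model_dist Spherical (G t) (G (t + 1)) = d"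
    using G(7) by auto
  moreover have "G t \<in> model Spherical" for t
    using G(4-6) by (simp add: span_qi_qj_qk)
  ultimately have "G \<in> curves Spherical"
    using G(8) unfolding curves_def by blast
  moreover note curve_of_multiplicative[of Spherical G t0, OF _ G(2,1,3)]
  ultimately show ?thesis
    using adm by (simp add: defines_curve_def) (simp add: G_def conjugate_def)
qed

lemma plane_to_hyperboloid:
  assumes form: "\<And>t. cscale lam (u t) \<in> real_form (- 1)"
    and diag: "\<And>t. cscale lam (u t) $ 1 $ 1 = 0"
    and det: "\<And>t. det (cscale lam (u t)) = of_real s" and s: "s \<noteq> 0" "1 + s > 0"
    and nz: "\<And>t. cscale lam (u t) + cscale lam (u (t + 1)) \<noteq> 0"
  shows "admissible lam u \<and> defines_curve Hyperbolic t0 (assoc_transport t0 lam u) \<and>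
    (\<forall>t. curve_of Hyperbolic t0 (assoc_transport t0 lam u) t =
       matrix_inv (assoc_map t0 lam u t) ** qk ** assoc_map t0 lam u t)"
proof -
  define G where "G t = conjugate (assoc_map t0 lam u t) qk" for t
  note G = conjugate_assoc_map_qk[where lam = lam and u = u and ?t0.0 = t0,
      OF form diag det s nz, folded G_def]
  have adm: "admissible lam u"
    using form diag det s(2) by (rule admissible_off_diagonal)
  have *: "G t \<noteq> G (t + 1)" for t
    using G(7)[of t] ratio_neq_one(1)[OF s] G(6)[of t]
    by (metis mip_self of_real_1 of_real_eq_iff)
  moreover have "G (t + 1) \<noteq> G (t + 2)" for t
    using *[of "t + 1"] by (simp add: add.assoc)
  moreover have "\<exists>d. \<forall>t. model_dist Hyperbolic (G t) (G (t + 1)) = d"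
    using G(7) by auto
  moreover have model: "G t \<in> model Hyperbolic" for t
    using G(4-6) by (simp add: span_sigma1_sigma2_qk)
  moreover have "G t \<in> upper_sheet" for t
  proof -
    obtain r where "r > 0" "det (assoc_map t0 lam u t) = of_real r"
      using G(9) by blast
    then have "Im (G t $ 1 $ 1) < 0"
      using Im_conjugate_qk assoc_map_real_form[OF adm form] by (simp add: G_def)
    then show ?thesis
      using model by (simp add: upper_sheet_iff del: model.simps)
  qed
  ultimately have "G \<in> curves Hyperbolic"
    using G(8) unfolding curves_def by blast
  moreover note curve_of_multiplicative[of Hyperbolic G t0, OF _ G(2,1,3)]
  ultimately show ?thesis
    using adm by (simp add: defines_curve_def) (simp add: G_def conjugate_def)
qed

section \<open>From curves on the sphere and the hyperboloid to plane curves\<close>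

text \<open>The determinants of 1 + u and 1 - u are 2 (1 + c) and 2 (1 - c), so
  \<open>c \<noteq> 1\<close> and \<open>c \<noteq> - 1\<close> give admissibility. The new
  determinant (1 - c) / (1 + c) is tan^2 (d/2) for c = cos d and -tanh^2 (d/2) for c = cosh
  d.\<close>

lemma assoc_transport_curved:
  fixes t0 :: int and F :: "int \<Rightarrow> cmat"
  defines "u \<equiv> \<lambda>t. F (t + 1) ** matrix_inv (F t)"
  assumes form: "\<And>t. F t \<in> real_form \<epsilon>" and trace: "\<And>t. trace (F t) = 0"
    and det: "\<And>t. det (F t) = 1" and init: "F t0 = qk"
    and mip: "\<And>t. mip (F t) (F (t + 1)) = of_real c" and c: "c \<noteq> 1" "c \<noteq> - 1"
    and neq: "\<And>t. F t \<noteq> F (t + 2)"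
  shows "admissible 1 u"
    and "assoc_transport t0 1 u t \<in> real_form \<epsilon>"
    and "assoc_transport t0 1 u t $ 1 $ 1 = 0"
    and "det (assoc_transport t0 1 u t) = of_real ((1 - c) / (1 + c))"
    and "assoc_transport t0 1 u t + assoc_transport t0 1 u (t + 1) \<noteq> 0"
proof -
  define \<Phi> where "\<Phi> = assoc_map t0 1 u"
  have invF: "invertible (F t)" for t
    by (simp add: invertible_det_nz det)
  have sq: "F t ** F t = - mat 1" for t
    using square_trace_free[OF trace] det by simp
  have "F t ** (- F t) = mat 1" for t
    by (simp add: mult_minus sq)
  then have Finv: "matrix_inv (F t) = - F t" for t
    by (rule matrix_inv_eqI)
  have uF: "u t ** F t = F (t + 1)" for t
    by (simp add: u_def matrix_inv_works[OF invF] flip: matrix_mul_assoc)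
  have form_u: "u t \<in> real_form \<epsilon>" for t
    unfolding u_def by (intro real_form_mult real_form_matrix_inv form invF)
  have det_u: "det (u t) = 1" for t
    using arg_cong[OF uF[of t], of det] by (simp add: det_mul det)
  have trace_u: "trace (u t) = 2 * of_real c" for t
    using mip_left_mult[of "F t" "u t"] mip[of t] by (simp add: uF det field_simps)
  have det_plus: "det (mat 1 + u t) = of_real (2 * (1 + c))"
    and det_minus: "det (mat 1 - u t) = of_real (2 * (1 - c))" for t
    by (simp_all add: det_one_plus det_one_minus trace_u det_u)
  have c': "2 * (1 + c) \<noteq> 0" "2 * (1 - c) \<noteq> 0"
    using c by auto
  have inv_plus: "invertible (mat 1 + u t)" and inv_minus: "invertible (mat 1 - u t)" for t
    using c' by (simp_all only: invertible_det_nz det_plus det_minus of_real_eq_0_iff) auto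
  show adm: "admissible 1 u"
    using inv_plus inv_minus by (simp add: admissible_def)
  note inv = assoc_map_invertible[OF adm, of t0, folded \<Phi>_def]
  have U: "assoc_transport t0 1 u t = conjugate (\<Phi> t) (cayley (u t))"
    and U': "assoc_transport t0 1 u t = conjugate (\<Phi> (t + 1)) (cayley (u t))" for t
    using assoc_transport_eq_conjugate_cayley[OF adm] unfolding \<Phi>_def by auto
  have form_\<Phi>: "\<Phi> t \<in> real_form \<epsilon>" for t
    unfolding \<Phi>_def using adm by (rule assoc_map_real_form) (simp add: form_u)
  show form_U: "assoc_transport t0 1 u t \<in> real_form \<epsilon>"
    unfolding U by (intro real_form_conjugate form_\<Phi> inv real_form_cayley form_u inv_plus)
  have "2 * (1 - c) / (2 * (1 + c)) = (1 - c) / (1 + c)"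
    by (rule mult_divide_mult_cancel_left) simp
  then show "det (assoc_transport t0 1 u t) = of_real ((1 - c) / (1 + c))"
    by (simp only: U det_conjugate[OF inv] det_cayley[OF inv_plus] det_plus det_minus
        of_real_divide [symmetric])

  have u: "u t = - (F (t + 1) ** F t)" for t
    unfolding u_def Finv by (rule mult_minus)
  \<comment> \<open>Both \<open>F (t + 1) ** (mat 1 + u t)\<close> and
    \<open>(mat 1 + u t) ** F t\<close> equal \<open>F t + F (t + 1)\<close>.\<close>
  have "conjugate (mat 1 + u t) (F (t + 1)) = F t" for t
  proof -
    have "F (t + 1) ** u t = - (F (t + 1) ** F (t + 1) ** F t)"
      by (simp add: u mult_minus matrix_mul_assoc)
    also have "\<dots> = F t"
      by (simp add: sq mult_minus)
    finally have "F (t + 1) ** (mat 1 + u t) = (mat 1 + u t) ** F t"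
      using uF[of t] by (simp add: cmat_eq_iff mult_nth algebra_simps)
    then show ?thesis
      by (simp add: conjugate_def flip: matrix_mul_assoc)
        (simp add: matrix_mul_assoc matrix_inv_works[OF inv_plus])
  qed
  then have "conjugate (\<Phi> (t + 1)) (F (t + 1)) = conjugate (\<Phi> t) (F t)" for t
    using conjugate_assoc_map_step[OF adm, of t0 t "F (t + 1)"] by (simp add: \<Phi>_def)
  then have "conjugate (\<Phi> t) (F t) = conjugate (\<Phi> t0) (F t0)" for t
    by (rule int_constant)
  then have conj_F: "conjugate (\<Phi> t) (F t) = qk" for t
    by (simp add: \<Phi>_def assoc_map_rec[OF adm] init)
  \<comment> \<open>Since \<open>det (u t) = 1\<close>, the Cayley transform has no scalar part and
    is a multiple of the commutator of \<open>F (t + 1)\<close> and \<open>F t\<close>. A commutator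
    with \<open>F t\<close> anticommutes with \<open>F t\<close> because the square of
    \<open>F t\<close> is scalar.\<close>
  have "cayley (u t) ** F t = - (F t ** cayley (u t))" for t
  proof -
    have adj: "adjugate (u t) - u t = F (t + 1) ** F t - F t ** F (t + 1)"
      by (simp add: u adjugate_minus adjugate_mult adjugate_trace_free[OF trace] mult_minus)
    have "cayley (u t) = cscale (1 / det (mat 1 + u t)) (F (t + 1) ** F t - F t ** F (t + 1))"
      by (simp only: cayley_det_one[OF det_u inv_plus] adj)
    moreover have "(F (t + 1) ** F t - F t ** F (t + 1)) ** F t =
        - (F t ** (F (t + 1) ** F t - F t ** F (t + 1)))"
    proof -
      have "F (t + 1) ** F t ** F t = F t ** F t ** F (t + 1)"
        by (simp add: sq mult_minus flip: matrix_mul_assoc [of "F (t + 1)"])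
      then show ?thesis
        by (simp add: mult_diff matrix_mul_assoc)
    qed
    ultimately show ?thesis
      by (simp only: cscale_mult) (simp add: cmat_eq_iff)
  qed
  then have "conjugate (\<Phi> t) (cayley (u t)) ** qk = - (qk ** conjugate (\<Phi> t) (cayley (u t)))"
    using conj_F[of t] conjugate_mult[OF inv] conjugate_minus by metis
  then show "assoc_transport t0 1 u t $ 1 $ 1 = 0"
    unfolding U by (rule anticommuting_qk_nth)
  show "assoc_transport t0 1 u t + assoc_transport t0 1 u (t + 1) \<noteq> 0"
  proof
    assume "assoc_transport t0 1 u t + assoc_transport t0 1 u (t + 1) = 0"
    then have "conjugate (\<Phi> (t + 1)) (cayley (u t) + cayley (u (t + 1))) = conjugate (\<Phi> (t + 1)) 0"
      unfolding U'[of t] U[of "t + 1"] conjugate_add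
      by (simp add: conjugate_def cmat_eq_iff mult_nth)
    then have "cayley (u t) + cayley (u (t + 1)) = 0"
      by (rule conjugate_eqD[OF inv])
    then have "u t ** u (t + 1) = mat 1"
      by (intro cayley_add_eq_zero inv_plus)
    \<comment> \<open>The order must be reversed: two steps along the curve apply \<open>u t\<close>
      first.\<close>
    then have "u (t + 1) ** u t = mat 1"
      by (simp add: matrix_left_right_inverse)
    then have "F t = u (t + 1) ** (u t ** F t)"
      by (simp add: matrix_mul_assoc)
    also have "\<dots> = F (t + 2)"
      using uF[of t] uF[of "t + 1"] by (simp add: add.assoc)
    finally show False
      using neq by blast
  qed
qed

section \<open>Inner products of two points on the sphere and on the hyperboloid\<close>

text \<open>Cauchy-Schwarz with its equality cases: on the quaternions \<open>det\<close> is the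
  positive definite \<open>q\<close>, and 2 - 2c and 2 + 2c are its values at \<open>F - G\<close>
  and \<open>F + G\<close>.\<close>

lemma spherical_mip:
  assumes F: "F \<in> model Spherical" and G: "G \<in> model Spherical"
  obtains c where "mip F G = of_real c" "\<bar>c\<bar> \<le> 1" "c = 1 \<Longrightarrow> F = G" "c = - 1 \<Longrightarrow> G = - F"
proof -
  define q where "q A = (cmod (A $ 1 $ 1))\<^sup>2 + (cmod (A $ 1 $ 2))\<^sup>2" for A :: cmat
  have form: "F \<in> real_form 1" "G \<in> real_form 1" and det: "det F = 1" "det G = 1"
    using F G by (simp_all add: span_qi_qj_qk)
  have det_q: "det A = of_real (q A)" if "A \<in> real_form 1" for A
    using real_form_det[OF that] by (simp add: q_def)
  have q0: "A = 0" if "A \<in> real_form 1" "q A = 0" for A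
    using that by (simp add: q_def real_form_def sum_power2_eq_zero_iff cmat_eq_iff)
  define c where "c = 1 - q (F - G) / 2"
  have minus: "2 - 2 * mip F G = of_real (q (F - G))"
    using det_diff_mip[of F G] det_q[OF real_form_diff[OF form]] det by simp
  have plus: "2 + 2 * mip F G = of_real (q (F + G))"
    using det_add_mip[of F G] det_q[OF real_form_add[OF form]] det by simp
  have mip: "mip F G = of_real c"
    using minus by (simp add: c_def field_simps)
  have "complex_of_real (2 + 2 * c) = of_real (q (F + G))"
    using plus by (simp add: mip)
  then have c': "2 + 2 * c = q (F + G)"
    by (simp only: of_real_eq_iff)
  have nonneg: "q A \<ge> 0" for A
    by (simp add: q_def)
  show ?thesis
  proof
    show "mip F G = of_real c"
      by (rule mip)
    show "\<bar>c\<bar> \<le> 1"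
      using nonneg[of "F - G"] nonneg[of "F + G"] c' by (simp add: c_def)
    show "F = G" if "c = 1"
      using q0[OF real_form_diff[OF form]] that by (simp add: c_def)
    show "G = - F" if "c = - 1"
      using q0[OF real_form_add[OF form]] c' that by (simp add: eq_neg_iff_add_eq_0 add.commute)
  qed
qed

text \<open>Reversed Cauchy-Schwarz for the indefinite form; it needs both points on one sheet,
  since passing to the other sheet flips the sign of \<open>c\<close>.\<close>

lemma hyperbolic_mip:
  assumes F: "F \<in> model Hyperbolic" and G: "G \<in> model Hyperbolic"
    and sheet: "Im (F $ 1 $ 1) * Im (G $ 1 $ 1) > 0"
  obtains c where "mip F G = of_real c" "1 \<le> c" "c = 1 \<Longrightarrow> F = G"
proof -
  define p x y where "p A = Im (A $ 1 $ 1)" and "x A = Re (A $ 1 $ 2)" and "y A = Im (A $ 1 $ 2)"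
    for A :: cmat
  have form: "F \<in> real_form (- 1)" "G \<in> real_form (- 1)"
    and trace: "trace F = 0" "trace G = 0" and det: "det F = 1" "det G = 1"
    using F G by (simp_all add: span_sigma1_sigma2_qk)
  have coords: "A $ 1 $ 1 = \<i> * of_real (p A)" "A $ 1 $ 2 = of_real (x A) + \<i> * of_real (y A)"
    "A $ 2 $ 1 = of_real (x A) - \<i> * of_real (y A)" "A $ 2 $ 2 = - \<i> * of_real (p A)"
    if "A \<in> real_form (- 1)" "trace A = 0" for A
    using that by (simp_all add: real_form_def trace_cmat complex_eq_iff p_def x_def y_def)
  have hyp: "(p A)\<^sup>2 = 1 + (x A)\<^sup>2 + (y A)\<^sup>2" if "A \<in> real_form (- 1)" "trace A = 0" "det A = 1" for A
    using that(3) coords[OF that(1,2)]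
    by (simp add: det_2 complex_eq_iff power2_eq_square algebra_simps)
  define r where "r = x F * x G + y F * y G"
  define c where "c = p F * p G - r"
  have mip: "mip F G = of_real c"
    using coords[OF form(1) trace(1)] coords[OF form(2) trace(2)]
    by (simp add: mip_def trace_cmat mult_nth c_def r_def complex_eq_iff field_simps)
  text \<open>The defect in \<open>1 + r \<le> p F * p G\<close> as a sum of squares, which also settles equality.\<close>
  have sos: "(p F * p G)\<^sup>2 =
      (1 + r)\<^sup>2 + (x F - x G)\<^sup>2 + (y F - y G)\<^sup>2 + (x F * y G - y F * x G)\<^sup>2"
    unfolding power_mult_distrib hyp[OF form(1) trace(1) det(1)] hyp[OF form(2) trace(2) det(2)] r_def
    by (simp add: power2_eq_square algebra_simps)
  then have "(1 + r)\<^sup>2 \<le> (p F * p G)\<^sup>2"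
    by (simp add: add.assoc)
  \<comment> \<open>The sheet condition makes \<open>p F * p G\<close> positive, which permits
    dropping the squares.\<close>
  then have le: "1 + r \<le> p F * p G"
    by (rule power2_le_imp_le) (use sheet in \<open>simp add: p_def\<close>)
  show ?thesis
  proof
    show "mip F G = of_real c"
      by (rule mip)
    show "1 \<le> c"
      using le by (simp add: c_def)
    assume "c = 1"
    then have "p F * p G = 1 + r"
      by (simp add: c_def)
    then have "(x F - x G)\<^sup>2 + (y F - y G)\<^sup>2 + (x F * y G - y F * x G)\<^sup>2 = 0"
      using sos by simp
    then have xy: "x F = x G" "y F = y G"
      by (simp_all add: add_nonneg_eq_0_iff)
    have "(p F)\<^sup>2 = (p G)\<^sup>2"
      using hyp[OF form(1) trace(1) det(1)] hyp[OF form(2) trace(2) det(2)] xy by simp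
    moreover have "p F \<noteq> - p G"
      using sheet by (auto simp: p_def mult_less_0_iff zero_less_mult_iff)
    ultimately have "p F = p G"
      by (simp add: power2_eq_iff)
    then show "F = G"
      using xy coords[OF form(1) trace(1)] coords[OF form(2) trace(2)] by (simp add: cmat_eq_iff)
  qed
qed

section \<open>Plane curves obtained from the two curved models\<close>

lemma sphere_to_plane:
  assumes F: "F \<in> curves Spherical" and init: "F t0 = qk"
  shows "admissible 1 (transport Spherical F) \<and>
    defines_curve Euclidean t0 (assoc_transport t0 1 (transport Spherical F))"
proof -
  have model: "F t \<in> model Spherical" and anti: "F (t + 1) \<noteq> - F t"
    and neq: "F t \<noteq> F (t + 1)" and neq2: "F t \<noteq> F (t + 2)" for t
    using F by (auto simp: curves_def simp del: model.simps)
  obtain d where d: "arccos (Re (mip (F t) (F (t + 1)))) = d" for t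
    using F by (auto simp: curves_def)
  have c_ex: "\<exists>c. mip (F t) (F (t + 1)) = of_real c \<and> \<bar>c\<bar> \<le> 1 \<and> c \<noteq> 1 \<and> c \<noteq> - 1" for t
    using spherical_mip[OF model[of t] model[of "t + 1"]] neq[of t] anti[of t] by metis
  then obtain c where c: "mip (F t) (F (t + 1)) = of_real (c t)" "\<bar>c t\<bar> \<le> 1" "c t \<noteq> 1" "c t \<noteq> - 1" for t
    by metis
  \<comment> \<open>Constant distance gives constant inner product only because arccos is injective
    on [-1, 1], which is why the bound on \<open>c t\<close> is carried along.\<close>
  have "c t = c t0" for t
    using d[of t] d[of t0] arccos_eq_iff[of "c t" "c t0"] c(1,2) by simp
  then have mip: "mip (F t) (F (t + 1)) = of_real (c t0)" for t
    using c(1) by metis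
  have u: "transport Spherical F = (\<lambda>t. F (t + 1) ** matrix_inv (F t))"
    by auto
  have props: "F t \<in> real_form 1" "trace (F t) = 0" "det (F t) = 1" for t
    using model[of t] by (simp_all add: span_qi_qj_qk)
  note U = assoc_transport_curved[of F, OF props init mip c(3,4) neq2, folded u]
  have "of_real ((1 - c t0) / (1 + c t0)) \<noteq> (0 :: complex)"
    using c(3,4)[of t0] by (simp only: of_real_eq_0_iff) auto
  with U show ?thesis
    by (auto simp: span_qi_qj simp del: transport.simps of_real_divide intro!: defines_curve_Euclidean)
qed

text \<open>Here c > 1 makes the determinant of the new transport matrix negative. The factor
  \<open>\<i>\<close> reverses this sign and carries off-diagonal split quaternions to off-diagonal
  quaternions, that is, into the plane.\<close>

lemma hyperboloid_to_plane:
  assumes F: "F \<in> curves Hyperbolic" and init: "F t0 = qk"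
  shows "admissible 1 (transport Hyperbolic F) \<and>
    defines_curve Euclidean t0 (\<lambda>t. cscale \<i> (assoc_transport t0 1 (transport Hyperbolic F) t))"
proof -
  have model: "F t \<in> model Hyperbolic"
    and neq: "F t \<noteq> F (t + 1)" and neq2: "F t \<noteq> F (t + 2)" for t
    using F by (auto simp: curves_def simp del: model.simps)
  have "range F \<subseteq> upper_sheet \<or> range F \<subseteq> lower_sheet"
    using F by (auto simp: curves_def)
  then have sheet: "Im (F t $ 1 $ 1) * Im (F s $ 1 $ 1) > 0" for s t
    by (auto simp: image_subset_iff upper_sheet_iff lower_sheet_iff zero_less_mult_iff)
  obtain d where d: "arcosh (Re (mip (F t) (F (t + 1)))) = d" for t
    using F by (auto simp: curves_def)
  have c_ex: "\<exists>c. mip (F t) (F (t + 1)) = of_real c \<and> c > 1" for t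
    using hyperbolic_mip[OF model[of t] model[of "t + 1"] sheet] neq[of t] by (metis less_eq_real_def)
  then obtain c where c: "mip (F t) (F (t + 1)) = of_real (c t)" "c t > 1" for t
    by metis
  have "c t = c t0" for t
  proof -
    have "arcosh (c t) = arcosh (c t0)"
      using d[of t] d[of t0] c(1) by simp
    then show ?thesis
      using c(2) by (metis cosh_arcosh_real less_eq_real_def)
  qed
  then have mip: "mip (F t) (F (t + 1)) = of_real (c t0)" for t
    using c(1) by metis
  have c1: "c t0 \<noteq> 1" "c t0 \<noteq> - 1"
    using c(2)[of t0] by auto
  have u: "transport Hyperbolic F = (\<lambda>t. F (t + 1) ** matrix_inv (F t))"
    by auto
  have props: "F t \<in> real_form (- 1)" "trace (F t) = 0" "det (F t) = 1" for t
    using model[of t] by (simp_all add: span_sigma1_sigma2_qk)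
  note U = assoc_transport_curved[of F, OF props init mip c1 neq2, folded u]
  let ?U = "assoc_transport t0 1 (transport Hyperbolic F)"
  have "defines_curve Euclidean t0 (\<lambda>t. cscale \<i> (?U t))"
  proof (rule defines_curve_Euclidean)
    show "cscale \<i> (?U t) \<in> model Euclidean" for t
      using U(2)[of t] U(3)[of t] by (simp add: span_qi_qj real_form_def)
    show "det (cscale \<i> (?U t)) = - of_real ((1 - c t0) / (1 + c t0))" for t
      unfolding det_cscale U(4) power2_i by (rule mult_minus1)
    show "- complex_of_real ((1 - c t0) / (1 + c t0)) \<noteq> 0"
      using c1 by (simp only: neg_equal_0_iff_equal of_real_eq_0_iff) auto
    show "cscale \<i> (?U t) + cscale \<i> (?U (t + 1)) \<noteq> 0" for t
      using U(5)[of t] by (simp add: cscale_eq_0_iff flip: cscale_add)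
  qed
  with U(1) show ?thesis
    by blast
qed

lemma euclidean_curve_transport:
  assumes "F \<in> euclidean_curves \<eta>"
  shows "transport Euclidean F t \<in> {A \<in> real_form 1. A $ 1 $ 1 = 0}"
    and "det (transport Euclidean F t) = of_real (\<eta>\<^sup>2)"
    and "transport Euclidean F t + transport Euclidean F (t + 1) \<noteq> 0"
proof -
  have "F t \<in> model Euclidean" "F (t + 1) \<in> model Euclidean" "F t \<noteq> F (t + 2)"
    and "mip (F (t + 1) - F t) (F (t + 1) - F t) = of_real (\<eta>\<^sup>2)"
    using assms by (auto simp: euclidean_curves_def curves_def simp del: model.simps)
  then show "transport Euclidean F t \<in> {A \<in> real_form 1. A $ 1 $ 1 = 0}"
    and "det (transport Euclidean F t) = of_real (\<eta>\<^sup>2)"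
    and "transport Euclidean F t + transport Euclidean F (t + 1) \<noteq> 0"
    by (simp_all add: mip_self add.assoc span_qi_qj real_form_diff)
qed

theorem mainTheorem6:
  fixes t0 :: int
  shows
    "(\<forall>(\<eta>::real) (F :: int \<Rightarrow> cmat).
        \<eta> > 0 \<and> F \<in> euclidean_curves \<eta> \<and> F t0 = 0 \<longrightarrow>
          (\<forall>lam::complex. lam \<in> \<real> - {0} \<longrightarrow>
             admissible lam (transport Euclidean F) \<and>
             defines_curve Spherical t0 (assoc_transport t0 lam (transport Euclidean F)) \<and>
             (\<forall>t. curve_of Spherical t0 (assoc_transport t0 lam (transport Euclidean F)) t =
                matrix_inv (assoc_map t0 lam (transport Euclidean F) t) ** qk **
                  assoc_map t0 lam (transport Euclidean F) t)) \<and>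
          (\<forall>lam::complex. Re lam = 0 \<and> 0 < cmod lam \<and> cmod lam < 1 / \<eta> \<longrightarrow>
             admissible lam (transport Euclidean F) \<and>
             defines_curve Hyperbolic t0 (assoc_transport t0 lam (transport Euclidean F)) \<and>
             (\<forall>t. curve_of Hyperbolic t0 (assoc_transport t0 lam (transport Euclidean F)) t =
                matrix_inv (assoc_map t0 lam (transport Euclidean F) t) ** qk **
                  assoc_map t0 lam (transport Euclidean F) t))) \<and>
     (\<forall>F :: int \<Rightarrow> cmat. F \<in> curves Spherical \<and> F t0 = qk \<longrightarrow>
        admissible 1 (transport Spherical F) \<and>
        defines_curve Euclidean t0 (assoc_transport t0 1 (transport Spherical F))) \<and>
     (\<forall>F :: int \<Rightarrow> cmat. F \<in> curves Hyperbolic \<and> F t0 = qk \<longrightarrow>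
        admissible 1 (transport Hyperbolic F) \<and>
        defines_curve Euclidean t0
          (\<lambda>t. cscale \<i> (assoc_transport t0 1 (transport Hyperbolic F) t)))"
proof (intro conjI[OF _ conjI] allI impI; (elim conjE)?)
  fix \<eta> :: real and F :: "int \<Rightarrow> cmat"
  assume \<eta>: "\<eta> > 0" and F: "F \<in> euclidean_curves \<eta>"
  let ?u = "transport Euclidean F"
  note u = euclidean_curve_transport[OF F]
  have nz: "cscale lam (?u t) + cscale lam (?u (t + 1)) \<noteq> 0" if "lam \<noteq> 0" for lam t
    using u(3)[of t] that by (simp add: cscale_eq_0_iff flip: cscale_add del: transport.simps)
  have diag: "cscale lam (?u t) $ 1 $ 1 = 0" for lam t
    using u(1)[of t] by (simp del: transport.simps)
  show "(\<forall>lam::complex. lam \<in> \<real> - {0} \<longrightarrow>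
             admissible lam ?u \<and>
             defines_curve Spherical t0 (assoc_transport t0 lam ?u) \<and>
             (\<forall>t. curve_of Spherical t0 (assoc_transport t0 lam ?u) t =
                matrix_inv (assoc_map t0 lam ?u t) ** qk ** assoc_map t0 lam ?u t)) \<and>
        (\<forall>lam::complex. Re lam = 0 \<and> 0 < cmod lam \<and> cmod lam < 1 / \<eta> \<longrightarrow>
             admissible lam ?u \<and>
             defines_curve Hyperbolic t0 (assoc_transport t0 lam ?u) \<and>
             (\<forall>t. curve_of Hyperbolic t0 (assoc_transport t0 lam ?u) t =
                matrix_inv (assoc_map t0 lam ?u t) ** qk ** assoc_map t0 lam ?u t))"
  proof (intro conjI[of "\<forall>x. _ x"] allI impI)
    fix lam :: complex
    assume "lam \<in> \<real> - {0}"
    then obtain x where x: "lam = of_real x" "x \<noteq> 0"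
      by (auto elim: Reals_cases)
    show "admissible lam ?u \<and>
        defines_curve Spherical t0 (assoc_transport t0 lam ?u) \<and>
        (\<forall>t. curve_of Spherical t0 (assoc_transport t0 lam ?u) t =
           matrix_inv (assoc_map t0 lam ?u t) ** qk ** assoc_map t0 lam ?u t)"
    \<comment> \<open>\<open>s\<close> is \<open>lam\<close> squared times the squared edge length;
      it is positive here, so no bound on \<open>lam\<close> arises.\<close>
    proof (rule plane_to_sphere[of lam ?u, OF _ diag _ _ _ nz, where s = "x\<^sup>2 * \<eta>\<^sup>2"])
      show "cscale lam (?u t) \<in> real_form 1" for t
        using u(1)[of t] by (simp add: x(1) real_form_def del: transport.simps)
      show "det (cscale lam (?u t)) = of_real (x\<^sup>2 * \<eta>\<^sup>2)" for t
        unfolding det_cscale u(2) by (simp add: x(1))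
      show "x\<^sup>2 * \<eta>\<^sup>2 \<noteq> 0" "lam \<noteq> 0"
        using x \<eta> by auto
      show "1 + x\<^sup>2 * \<eta>\<^sup>2 > 0"
        by (intro add_pos_nonneg) auto
    qed
  next
    fix lam :: complex
    assume lam: "Re lam = 0 \<and> 0 < cmod lam \<and> cmod lam < 1 / \<eta>"
    define y where "y = Im lam"
    have y: "lam = \<i> * of_real y" "y \<noteq> 0" "\<bar>y\<bar> < 1 / \<eta>"
      using lam by (auto simp: y_def complex_eq_iff cmod_def)
    show "admissible lam ?u \<and>
        defines_curve Hyperbolic t0 (assoc_transport t0 lam ?u) \<and>
        (\<forall>t. curve_of Hyperbolic t0 (assoc_transport t0 lam ?u) t =
           matrix_inv (assoc_map t0 lam ?u t) ** qk ** assoc_map t0 lam ?u t)"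
    proof (rule plane_to_hyperboloid[of lam ?u, OF _ diag _ _ _ nz, where s = "- (y\<^sup>2 * \<eta>\<^sup>2)"])
      show "cscale lam (?u t) \<in> real_form (- 1)" for t
        using u(1)[of t] by (simp add: y(1) real_form_def del: transport.simps)
      show "det (cscale lam (?u t)) = of_real (- (y\<^sup>2 * \<eta>\<^sup>2))" for t
        unfolding det_cscale u(2) by (simp add: y(1) power_mult_distrib)
      show "- (y\<^sup>2 * \<eta>\<^sup>2) \<noteq> 0" "lam \<noteq> 0"
        using y \<eta> by auto
      \<comment> \<open>Squaring this turns the bound on |lam| into 1 + s > 0 for the negative
        \<open>s\<close> of the imaginary case.\<close>
      have "\<bar>y\<bar> * \<eta> < 1"
        using y(3) \<eta> by (simp add: field_simps)
      then have "(\<bar>y\<bar> * \<eta>)\<^sup>2 < 1"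
        using \<eta> by (intro power_less_one_iff[THEN iffD2]) auto
      then show "1 + - (y\<^sup>2 * \<eta>\<^sup>2) > 0"
        by (simp add: power_mult_distrib)
    qed
  qed
qed (use sphere_to_plane hyperboloid_to_plane in blast)+

end
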